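(* Let $X$ be a set. Strong model structures on the power set $\mathcal{P}(X)$ are in bijection with ordered pairs $(\mathrm{Cl},\mathrm{Int})$, where $\mathrm{Cl}$ is a closure operator on $X$, and $\mathrm{Int}$ is an interior operator on $X$, satisfying the conditions: (i) For each subset $U$ of $X$, we have $\mathrm{Cl}(\mathrm{Int}(U)) = \mathrm{Int}(\mathrm{Cl}(U))$. (ii) If $U,V$ are subsets of $X$ such that $U\subseteq \mathrm{Int}(V)$ and $\mathrm{Cl}(U)\subseteq V$, then $\mathrm{Cl}(U)\subseteq \mathrm{Int}(V)$. (iii) If $U,V$ are subsets of $X$ such that $U\subseteq V$ and $\mathrm{Cl}(U) = \mathrm{Cl}(V)$ and $\mathrm{Int}(U) = \mathrm{Int}(V)$, then $U=V$.
   Context: $\mathcal{P}(X)$ is partially ordered by inclusion and regarded as a category with exactly one morphism $U\to V$ if $U\subseteq V$ and none otherwise. A closure operator on $X$ is a function $\mathrm{Cl}:\mathcal{P}(X)\to\mathcal{P}(X)$ which is idempotent, increasing ($Y\subseteq Z$ implies $\mathrm{Cl}(Y)\subseteq \mathrm{Cl}(Z)$) and extensive ($Y\subseteq \mathrm{Cl}(Y)$); equivalently an idempotent monad on $\mathcal{P}(X)$. (No topological axioms are assumed.) An interior operator is the dual notion: an idempotent, increasing function $\mathrm{Int}$ with $\mathrm{Int}(Y)\subseteq Y$; equivalently an idempotent comonad. A weak factorization system is a pair $(\mathcal{L},\mathcal{R})$ of classes of morphisms such that every morphism factors as a map in $\mathcal{L}$ followed by a map in $\mathcal{R}$, $\mathcal{L}$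 is the class of maps with the left lifting property with respect to $\mathcal{R}$, and $\mathcal{R}$ is the class of maps with the right lifting property with respect to $\mathcal{L}$. A model structure is a triple $(\mathrm{cof},\mathrm{we},\mathrm{fib})$ of retract-closed subcategories containing all objects such that $(\mathrm{cof}\cap \mathrm{we},\mathrm{fib})$ and $(\mathrm{cof},\mathrm{we}\cap \mathrm{fib})$ are weak factorization systems and $\mathrm{we}$ has the two-out-of-three property. Acyclic (co)fibrations are (co)fibrations which are weak equivalences. A model structure is strong if: whenever $g\circ f$ is an acyclic cofibration, $f$ is an acyclic cofibration; and whenever $g\circ f$ is an acyclic fibration, $g$ is an acyclic fibration. The bijection is the one sending a strong model structure to the pair ($\mathrm{Cl}$, $\mathrm{Int}$) in which $\mathrm{Cl}$ is fibrant replacement ($U\to \mathrm{Cl}(U)$ an acyclic cofibration, $\mathrm{Cl}(U)\to X$ a fibration) and $\mathrm{Int}$ is cofibrant replacement ($\emptyset\to \mathrm{Int}(U)$ a cofibration, $\mathrm{Int}(U)\to U$ an acyclic fibration). *)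

theory Defs
  imports "HOL-Library.FuncSet"
begin

section \<open>Categories\<close>

record ('o, 'm) cat =
  Obj :: "'o set"
  Arr :: "'m set"
  Dom :: "'m \<Rightarrow> 'o"
  Cod :: "'m \<Rightarrow> 'o"
  Id :: "'o \<Rightarrow> 'm"
  Comp :: "'m \<Rightarrow> 'm \<Rightarrow> 'm"  \<comment> \<open>\<open>Comp C g f\<close> is \<open>f\<close> followed by \<open>g\<close>\<close>

definition Hom :: "('o, 'm) cat \<Rightarrow> 'o \<Rightarrow> 'o \<Rightarrow> 'm set" where
  "Hom C a b = {f \<in> Arr C. Dom C f = a \<and> Cod C f = b}"

definition category :: "('o, 'm) cat \<Rightarrow> bool" where
  "category C \<longleftrightarrow>
     (\<forall>f\<in>Arr C. Dom C f \<in> Obj C \<and> Cod C f \<in> Obj C) \<and>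
     (\<forall>a\<in>Obj C. Id C a \<in> Hom C a a) \<and>
     (\<forall>f\<in>Arr C. \<forall>g\<in>Arr C. Cod C f = Dom C g \<longrightarrow>
        Comp C g f \<in> Hom C (Dom C f) (Cod C g)) \<and>
     (\<forall>f\<in>Arr C. Comp C f (Id C (Dom C f)) = f \<and> Comp C (Id C (Cod C f)) f = f) \<and>
     (\<forall>f\<in>Arr C. \<forall>g\<in>Arr C. \<forall>h\<in>Arr C. Cod C f = Dom C g \<longrightarrow> Cod C g = Dom C h \<longrightarrow>
        Comp C h (Comp C g f) = Comp C (Comp C h g) f)"

definition powerset_cat :: "'a set \<Rightarrow> ('a set, 'a set \<times> 'a set) cat" where
  "powerset_cat X =
     \<lparr>Obj = Pow X,
      Arr = {(U, V). U \<subseteq> V \<and> V \<subseteq> X},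
      Dom = fst,
      Cod = snd,
      Id = (\<lambda>U. (U, U)),
      Comp = (\<lambda>g f. (fst f, snd g))\<rparr>"

lemma category_powerset_cat: "category (powerset_cat X)"
  by (auto simp: category_def powerset_cat_def Hom_def)

definition wide_subcategory :: "('o, 'm) cat \<Rightarrow> 'm set \<Rightarrow> bool" where
  "wide_subcategory C S \<longleftrightarrow>
     S \<subseteq> Arr C \<and>
     (\<forall>a\<in>Obj C. Id C a \<in> S) \<and>
     (\<forall>f\<in>S. \<forall>g\<in>S. Cod C f = Dom C g \<longrightarrow> Comp C g f \<in> S)"

definition is_retract_of :: "('o, 'm) cat \<Rightarrow> 'm \<Rightarrow> 'm \<Rightarrow> bool" where
  "is_retract_of C f g \<longleftrightarrow>
     (\<exists>i\<in>Hom C (Dom C f) (Dom C g). \<exists>r\<in>Hom C (Dom C g) (Dom C f).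
      \<exists>j\<in>Hom C (Cod C f) (Cod C g). \<exists>s\<in>Hom C (Cod C g) (Cod C f).
        Comp C r i = Id C (Dom C f) \<and> Comp C s j = Id C (Cod C f) \<and>
        Comp C g i = Comp C j f \<and> Comp C f r = Comp C s g)"

definition retract_closed :: "('o, 'm) cat \<Rightarrow> 'm set \<Rightarrow> bool" where
  "retract_closed C S \<longleftrightarrow> (\<forall>f\<in>Arr C. \<forall>g\<in>S. is_retract_of C f g \<longrightarrow> f \<in> S)"

definition two_out_of_three :: "('o, 'm) cat \<Rightarrow> 'm set \<Rightarrow> bool" where
  "two_out_of_three C S \<longleftrightarrow>
     (\<forall>f\<in>Arr C. \<forall>g\<in>Arr C. Cod C f = Dom C g \<longrightarrow>
        (f \<in> S \<and> g \<in> S \<longrightarrow> Comp C g f \<in> S) \<and>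
        (f \<in> S \<and> Comp C g f \<in> S \<longrightarrow> g \<in> S) \<and>
        (g \<in> S \<and> Comp C g f \<in> S \<longrightarrow> f \<in> S))"

section \<open>Weak factorization systems and model structures\<close>

definition lifts :: "('o, 'm) cat \<Rightarrow> 'm \<Rightarrow> 'm \<Rightarrow> bool" where
  "lifts C l r \<longleftrightarrow>
     (\<forall>u\<in>Hom C (Dom C l) (Dom C r). \<forall>v\<in>Hom C (Cod C l) (Cod C r).
        Comp C r u = Comp C v l \<longrightarrow>
        (\<exists>h\<in>Hom C (Cod C l) (Dom C r). Comp C h l = u \<and> Comp C r h = v))"

definition llp :: "('o, 'm) cat \<Rightarrow> 'm set \<Rightarrow> 'm set" where
  "llp C R = {l \<in> Arr C. \<forall>r\<in>R. lifts C l r}"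

definition rlp :: "('o, 'm) cat \<Rightarrow> 'm set \<Rightarrow> 'm set" where
  "rlp C L = {r \<in> Arr C. \<forall>l\<in>L. lifts C l r}"

definition weak_factorization_system :: "('o, 'm) cat \<Rightarrow> 'm set \<Rightarrow> 'm set \<Rightarrow> bool" where
  "weak_factorization_system C L R \<longleftrightarrow>
     (\<forall>f\<in>Arr C. \<exists>l\<in>L. \<exists>r\<in>R. Cod C l = Dom C r \<and> f = Comp C r l) \<and>
     L = llp C R \<and> R = rlp C L"

record 'm model_data =
  cof :: "'m set"
  we :: "'m set"
  fib :: "'m set"

definition acyclic_cof :: "'m model_data \<Rightarrow> 'm set" where
  "acyclic_cof M = cof M \<inter> we M"

definition acyclic_fib :: "'m model_data \<Rightarrow> 'm set" where
  "acyclic_fib M = we M \<inter> fib M"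

definition model_structure :: "('o, 'm) cat \<Rightarrow> 'm model_data \<Rightarrow> bool" where
  "model_structure C M \<longleftrightarrow>
     (\<forall>S\<in>{cof M, we M, fib M}. wide_subcategory C S \<and> retract_closed C S) \<and>
     weak_factorization_system C (acyclic_cof M) (fib M) \<and>
     weak_factorization_system C (cof M) (acyclic_fib M) \<and>
     two_out_of_three C (we M)"

definition strong_model_structure :: "('o, 'm) cat \<Rightarrow> 'm model_data \<Rightarrow> bool" where
  "strong_model_structure C M \<longleftrightarrow>
     model_structure C M \<and>
     (\<forall>f\<in>Arr C. \<forall>g\<in>Arr C. Cod C f = Dom C g \<longrightarrow>
        (Comp C g f \<in> acyclic_cof M \<longrightarrow> f \<in> acyclic_cof M) \<and>
        (Comp C g f \<in> acyclic_fib M \<longrightarrow> g \<in> acyclic_fib M))"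

section \<open>Closure and interior operators\<close>

text \<open>
  Operators on \<open>Pow X\<close> are taken to be extensional, that is, equal to \<open>undefined\<close> outside
  \<open>Pow X\<close>, so that equality of HOL functions is equality of functions on \<open>Pow X\<close>.
\<close>

definition closure_operator :: "'a set \<Rightarrow> ('a set \<Rightarrow> 'a set) \<Rightarrow> bool" where
  "closure_operator X Cl \<longleftrightarrow>
     Cl \<in> Pow X \<rightarrow>\<^sub>E Pow X \<and>
     (\<forall>Y\<in>Pow X. Cl (Cl Y) = Cl Y) \<and>
     (\<forall>Y\<in>Pow X. \<forall>Z\<in>Pow X. Y \<subseteq> Z \<longrightarrow> Cl Y \<subseteq> Cl Z) \<and>
     (\<forall>Y\<in>Pow X. Y \<subseteq> Cl Y)"

definition interior_operator :: "'a set \<Rightarrow> ('a set \<Rightarrow> 'a set) \<Rightarrow> bool" where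
  "interior_operator X Intr \<longleftrightarrow>
     Intr \<in> Pow X \<rightarrow>\<^sub>E Pow X \<and>
     (\<forall>Y\<in>Pow X. Intr (Intr Y) = Intr Y) \<and>
     (\<forall>Y\<in>Pow X. \<forall>Z\<in>Pow X. Y \<subseteq> Z \<longrightarrow> Intr Y \<subseteq> Intr Z) \<and>
     (\<forall>Y\<in>Pow X. Intr Y \<subseteq> Y)"

section \<open>Fibrant and cofibrant replacement in a power set\<close>

text \<open>The terminal object of \<open>powerset_cat X\<close> is \<open>X\<close> and the initial object is \<open>{}\<close>.\<close>

definition fibrant_replacement ::
    "'a set \<Rightarrow> ('a set \<times> 'a set) model_data \<Rightarrow> 'a set \<Rightarrow> 'a set \<Rightarrow> bool" where
  "fibrant_replacement X M U K \<longleftrightarrow> (U, K) \<in> acyclic_cof M \<and> (K, X) \<in> fib M"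

definition cofibrant_replacement ::
    "('a set \<times> 'a set) model_data \<Rightarrow> 'a set \<Rightarrow> 'a set \<Rightarrow> bool" where
  "cofibrant_replacement M U K \<longleftrightarrow> ({}, K) \<in> cof M \<and> (K, U) \<in> acyclic_fib M"

definition replacement_operators ::
    "'a set \<Rightarrow> ('a set \<times> 'a set) model_data \<Rightarrow> ('a set \<Rightarrow> 'a set) \<times> ('a set \<Rightarrow> 'a set)" where
  "replacement_operators X M =
     ((\<lambda>U\<in>Pow X. THE K. fibrant_replacement X M U K),
      (\<lambda>U\<in>Pow X. THE K. cofibrant_replacement M U K))"

end

theory Submission
  imports Defs
begin

text \<open>
  In a poset a lift of \<open>(A, B)\<close> against \<open>(C, D)\<close> is just the implication
  \<open>A \<subseteq> C \<Longrightarrow> B \<subseteq> D \<Longrightarrow> B \<subseteq> C\<close>. Strength lets one recover the acyclic cofibrations from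
  \<open>Cl\<close>: lifting against \<open>(Cl U, X)\<close> and left cancellation show that \<open>(U, V)\<close> is an acyclic
  cofibration iff \<open>U \<subseteq> V \<subseteq> Cl U\<close>; dually \<open>(U, V)\<close> is an acyclic fibration iff
  \<open>Intr V \<subseteq> U \<subseteq> V\<close>. Solving the lifting problems, \<open>(U, V)\<close> is then a fibration iff
  \<open>Cl U \<inter> V \<subseteq> U\<close>, a cofibration iff \<open>V \<subseteq> U \<union> Intr V\<close>, and a weak equivalence, being an
  acyclic cofibration followed by an acyclic fibration, iff \<open>Intr V \<subseteq> Cl U\<close>. Conversely these
  formulas define a strong model structure: condition (i) makes weak equivalences compose, and
  condition (iii), applied to \<open>U \<union> Intr V \<subseteq> V\<close> and to \<open>U \<subseteq> Cl U \<inter> V\<close>, makes the acyclic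
  cofibrations and acyclic fibrations the right ones.
\<close>

section \<open>Categorical notions translated into inclusions of subsets\<close>

lemma Arr_powerset_iff: "(U, V) \<in> Arr (powerset_cat X) \<longleftrightarrow> U \<subseteq> V \<and> V \<subseteq> X"
  by (simp add: powerset_cat_def)

text \<open>Parallel arrows are equal, so both triangles commute automatically and only the
  existence of the diagonal matters.\<close>

lemma lifts_powerset_iff:
  assumes "A \<subseteq> B" "B \<subseteq> X" "C \<subseteq> D" "D \<subseteq> X"
  shows "lifts (powerset_cat X) (A, B) (C, D) \<longleftrightarrow> (A \<subseteq> C \<longrightarrow> B \<subseteq> D \<longrightarrow> B \<subseteq> C)"
  using assms by (auto simp: lifts_def Hom_def powerset_cat_def)

lemma wide_subcategory_powerset_iff:
  "wide_subcategory (powerset_cat X) S \<longleftrightarrow>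
     (\<forall>U V. (U, V) \<in> S \<longrightarrow> U \<subseteq> V \<and> V \<subseteq> X) \<and> (\<forall>U. U \<subseteq> X \<longrightarrow> (U, U) \<in> S) \<and>
     (\<forall>U V W. (U, V) \<in> S \<longrightarrow> (V, W) \<in> S \<longrightarrow> (U, W) \<in> S)"
  by (simp add: wide_subcategory_def powerset_cat_def Ball_def subset_iff[of S])

lemma two_out_of_three_powerset_iff:
  "two_out_of_three (powerset_cat X) S \<longleftrightarrow>
     (\<forall>U V W. U \<subseteq> V \<longrightarrow> V \<subseteq> W \<longrightarrow> W \<subseteq> X \<longrightarrow>
        ((U, V) \<in> S \<and> (V, W) \<in> S \<longrightarrow> (U, W) \<in> S) \<and>
        ((U, V) \<in> S \<and> (U, W) \<in> S \<longrightarrow> (V, W) \<in> S) \<and>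
        ((V, W) \<in> S \<and> (U, W) \<in> S \<longrightarrow> (U, V) \<in> S))"
  by (simp add: two_out_of_three_def powerset_cat_def Ball_def) (meson subset_trans)

text \<open>Retraction data contain inclusions in both directions between the domains and between
  the codomains, so antisymmetry identifies a retract with the arrow itself.\<close>

lemma retract_closed_powerset: "retract_closed (powerset_cat X) S"
proof -
  have "f = g" if "is_retract_of (powerset_cat X) f g" for f g
    using that by (auto simp: is_retract_of_def Hom_def powerset_cat_def prod_eq_iff)
  then show ?thesis
    by (auto simp: retract_closed_def)
qed

lemma in_llp_powerset_iff:
  assumes "R \<subseteq> Arr (powerset_cat X)"
  shows "(A, B) \<in> llp (powerset_cat X) R \<longleftrightarrow>
     A \<subseteq> B \<and> B \<subseteq> X \<and> (\<forall>C D. (C, D) \<in> R \<longrightarrow> A \<subseteq> C \<longrightarrow> B \<subseteq> D \<longrightarrow> B \<subseteq> C)"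
  using assms
  by (simp add: llp_def subset_iff[of R] Arr_powerset_iff Ball_def lifts_powerset_iff cong: conj_cong imp_cong)

lemma in_rlp_powerset_iff:
  assumes "L \<subseteq> Arr (powerset_cat X)"
  shows "(C, D) \<in> rlp (powerset_cat X) L \<longleftrightarrow>
     C \<subseteq> D \<and> D \<subseteq> X \<and> (\<forall>A B. (A, B) \<in> L \<longrightarrow> A \<subseteq> C \<longrightarrow> B \<subseteq> D \<longrightarrow> B \<subseteq> C)"
  using assms
  by (simp add: rlp_def subset_iff[of L] Arr_powerset_iff Ball_def lifts_powerset_iff cong: conj_cong imp_cong)

text \<open>The rule \<open>lift\<close> supplies the forward inclusion of both lifting equalities;
  \<open>left\<close> and \<open>right\<close> supply the two reverse inclusions.\<close>

lemma weak_factorization_system_powersetI: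
  assumes L: "L \<subseteq> Arr (powerset_cat X)"
    and R: "R \<subseteq> Arr (powerset_cat X)"
    and factor: "\<And>U V. U \<subseteq> V \<Longrightarrow> V \<subseteq> X \<Longrightarrow> \<exists>W. (U, W) \<in> L \<and> (W, V) \<in> R"
    and lift: "\<And>A B C D. (A, B) \<in> L \<Longrightarrow> (C, D) \<in> R \<Longrightarrow> A \<subseteq> C \<Longrightarrow> B \<subseteq> D \<Longrightarrow> B \<subseteq> C"
    and left: "\<And>A B. A \<subseteq> B \<Longrightarrow> B \<subseteq> X \<Longrightarrow>
      (\<And>C D. (C, D) \<in> R \<Longrightarrow> A \<subseteq> C \<Longrightarrow> B \<subseteq> D \<Longrightarrow> B \<subseteq> C) \<Longrightarrow> (A, B) \<in> L"
    and right: "\<And>C D. C \<subseteq> D \<Longrightarrow> D \<subseteq> X \<Longrightarrow>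
      (\<And>A B. (A, B) \<in> L \<Longrightarrow> A \<subseteq> C \<Longrightarrow> B \<subseteq> D \<Longrightarrow> B \<subseteq> C) \<Longrightarrow> (C, D) \<in> R"
  shows "weak_factorization_system (powerset_cat X) L R"
proof -
  have "\<exists>l\<in>L. \<exists>r\<in>R. Cod (powerset_cat X) l = Dom (powerset_cat X) r \<and> f = Comp (powerset_cat X) r l"
    if f_arr: "f \<in> Arr (powerset_cat X)" for f
  proof -
    obtain U V where f: "f = (U, V)"
      by fastforce
    then obtain W where W: "(U, W) \<in> L" "(W, V) \<in> R"
      using factor[of U V] f_arr by (auto simp: Arr_powerset_iff)
    show ?thesis
      unfolding f powerset_cat_def
      by (rule bexI[of _ "(U, W)"], rule bexI[of _ "(W, V)"]) (simp_all add: W)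
  qed
  moreover have "(A, B) \<in> L \<longleftrightarrow> (A, B) \<in> llp (powerset_cat X) R" for A B
  proof
    assume AB: "(A, B) \<in> L"
    have "A \<subseteq> B \<and> B \<subseteq> X"
      using subsetD[OF L AB] by (simp add: Arr_powerset_iff)
    then show "(A, B) \<in> llp (powerset_cat X) R"
      using lift[OF AB] by (simp add: in_llp_powerset_iff[OF R])
  qed (simp add: in_llp_powerset_iff[OF R] left)
  moreover have "(C, D) \<in> R \<longleftrightarrow> (C, D) \<in> rlp (powerset_cat X) L" for C D
  proof
    assume CD: "(C, D) \<in> R"
    have "C \<subseteq> D \<and> D \<subseteq> X"
      using subsetD[OF R CD] by (simp add: Arr_powerset_iff)
    then show "(C, D) \<in> rlp (powerset_cat X) L"
      using lift[OF _ CD] by (simp add: in_rlp_powerset_iff[OF L])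
  qed (simp add: in_rlp_powerset_iff[OF L] right)
  ultimately show ?thesis
    by (simp add: weak_factorization_system_def set_eq_iff)
qed

lemma weak_factorization_system_powersetD:
  assumes wfs: "weak_factorization_system (powerset_cat X) L R"
  shows "U \<subseteq> V \<Longrightarrow> V \<subseteq> X \<Longrightarrow> \<exists>W. (U, W) \<in> L \<and> (W, V) \<in> R"
    and "(A, B) \<in> L \<Longrightarrow> (C, D) \<in> R \<Longrightarrow> A \<subseteq> C \<Longrightarrow> B \<subseteq> D \<Longrightarrow> B \<subseteq> C"
    and "A \<subseteq> B \<Longrightarrow> B \<subseteq> X \<Longrightarrow>
      (\<And>C D. (C, D) \<in> R \<Longrightarrow> A \<subseteq> C \<Longrightarrow> B \<subseteq> D \<Longrightarrow> B \<subseteq> C) \<Longrightarrow> (A, B) \<in> L"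
    and "C \<subseteq> D \<Longrightarrow> D \<subseteq> X \<Longrightarrow>
      (\<And>A B. (A, B) \<in> L \<Longrightarrow> A \<subseteq> C \<Longrightarrow> B \<subseteq> D \<Longrightarrow> B \<subseteq> C) \<Longrightarrow> (C, D) \<in> R"
proof -
  have L: "L = llp (powerset_cat X) R" and R: "R = rlp (powerset_cat X) L"
    using wfs unfolding weak_factorization_system_def by blast+
  \<comment> \<open>Each class is a lifting class, and lifting classes consist of arrows by
    definition.\<close>
  have arr: "L \<subseteq> Arr (powerset_cat X)" "R \<subseteq> Arr (powerset_cat X)"
    by (subst L, force simp: llp_def, subst R, force simp: rlp_def)
  note L_iff = in_llp_powerset_iff[OF arr(2), folded L]
  note R_iff = in_rlp_powerset_iff[OF arr(1), folded R]
  show "\<exists>W. (U, W) \<in> L \<and> (W, V) \<in> R" if "U \<subseteq> V" "V \<subseteq> X"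
  proof -
    have "(U, V) \<in> Arr (powerset_cat X)"
      using that by (simp add: Arr_powerset_iff)
    then obtain l r where "l \<in> L" "r \<in> R" "Cod (powerset_cat X) l = Dom (powerset_cat X) r"
      "(U, V) = Comp (powerset_cat X) r l"
      using wfs unfolding weak_factorization_system_def by blast
    then show ?thesis
      by (cases l; cases r) (auto simp: powerset_cat_def)
  qed
  show "B \<subseteq> C" if "(A, B) \<in> L" "(C, D) \<in> R" "A \<subseteq> C" "B \<subseteq> D"
    using that L_iff[of A B] by meson
  show "(A, B) \<in> L" if "A \<subseteq> B" "B \<subseteq> X" "\<And>C D. (C, D) \<in> R \<Longrightarrow> A \<subseteq> C \<Longrightarrow> B \<subseteq> D \<Longrightarrow> B \<subseteq> C"
    using that L_iff[of A B] by meson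
  show "(C, D) \<in> R" if "C \<subseteq> D" "D \<subseteq> X" "\<And>A B. (A, B) \<in> L \<Longrightarrow> A \<subseteq> C \<Longrightarrow> B \<subseteq> D \<Longrightarrow> B \<subseteq> C"
    using that R_iff[of C D] by meson
qed

section \<open>Operator pairs and the classes of arrows they define\<close>

definition compatible_operators :: "'a set \<Rightarrow> ('a set \<Rightarrow> 'a set) \<Rightarrow> ('a set \<Rightarrow> 'a set) \<Rightarrow> bool" where
  "compatible_operators X Cl Intr \<longleftrightarrow> closure_operator X Cl \<and> interior_operator X Intr \<and>
     (\<forall>U\<in>Pow X. Cl (Intr U) = Intr (Cl U)) \<and>
     (\<forall>U\<in>Pow X. \<forall>V\<in>Pow X. U \<subseteq> Intr V \<longrightarrow> Cl U \<subseteq> V \<longrightarrow> Cl U \<subseteq> Intr V) \<and>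
     (\<forall>U\<in>Pow X. \<forall>V\<in>Pow X. U \<subseteq> V \<longrightarrow> Cl U = Cl V \<longrightarrow> Intr U = Intr V \<longrightarrow> U = V)"

text \<open>For a closure operator, \<open>fib\<close> says that \<open>U\<close> is relatively
  closed in \<open>V\<close>, being its own trace \<open>Cl U \<inter> V\<close>; dually,
  \<open>cof\<close> says that all points added to \<open>U\<close> lie in \<open>Intr V\<close>. A
  weak equivalence is tested by an inclusion of the cofibrant replacement of the target into the
  fibrant replacement of the source.\<close>

definition operator_model ::
    "'a set \<Rightarrow> ('a set \<Rightarrow> 'a set) \<Rightarrow> ('a set \<Rightarrow> 'a set) \<Rightarrow> ('a set \<times> 'a set) model_data" where
  "operator_model X Cl Intr =
     \<lparr>cof = {(U, V). U \<subseteq> V \<and> V \<subseteq> X \<and> V \<subseteq> U \<union> Intr V},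
      we = {(U, V). U \<subseteq> V \<and> V \<subseteq> X \<and> Intr V \<subseteq> Cl U},
      fib = {(U, V). U \<subseteq> V \<and> V \<subseteq> X \<and> Cl U \<inter> V \<subseteq> U}\<rparr>"

section \<open>From strong model structures to operators\<close>

context
  fixes X :: "'a set" and M
  assumes strong: "strong_model_structure (powerset_cat X) M"
begin

lemma model_wide:
  "wide_subcategory (powerset_cat X) (cof M)"
  "wide_subcategory (powerset_cat X) (we M)"
  "wide_subcategory (powerset_cat X) (fib M)"
  using strong by (simp_all add: strong_model_structure_def model_structure_def)

lemma model_arr:
  "(U, V) \<in> cof M \<Longrightarrow> U \<subseteq> V \<and> V \<subseteq> X"
  "(U, V) \<in> we M \<Longrightarrow> U \<subseteq> V \<and> V \<subseteq> X"
  "(U, V) \<in> fib M \<Longrightarrow> U \<subseteq> V \<and> V \<subseteq> X"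
  using model_wide unfolding wide_subcategory_powerset_iff by meson+

lemma acyclic_arr:
  "(U, V) \<in> acyclic_cof M \<Longrightarrow> U \<subseteq> V \<and> V \<subseteq> X"
  "(U, V) \<in> acyclic_fib M \<Longrightarrow> U \<subseteq> V \<and> V \<subseteq> X"
  by (auto simp: acyclic_cof_def acyclic_fib_def dest: model_arr)

lemma model_comp:
  "(U, V) \<in> cof M \<Longrightarrow> (V, W) \<in> cof M \<Longrightarrow> (U, W) \<in> cof M"
  "(U, V) \<in> we M \<Longrightarrow> (V, W) \<in> we M \<Longrightarrow> (U, W) \<in> we M"
  "(U, V) \<in> fib M \<Longrightarrow> (V, W) \<in> fib M \<Longrightarrow> (U, W) \<in> fib M"
  using model_wide unfolding wide_subcategory_powerset_iff by meson+

lemma acyclic_comp: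
  "(U, V) \<in> acyclic_cof M \<Longrightarrow> (V, W) \<in> acyclic_cof M \<Longrightarrow> (U, W) \<in> acyclic_cof M"
  "(U, V) \<in> acyclic_fib M \<Longrightarrow> (V, W) \<in> acyclic_fib M \<Longrightarrow> (U, W) \<in> acyclic_fib M"
  by (auto simp: acyclic_cof_def acyclic_fib_def intro: model_comp)

lemma we_cancel:
  assumes "(U, W) \<in> we M" "U \<subseteq> V" "(V, W) \<in> we M"
  shows "(U, V) \<in> we M"
proof -
  have "two_out_of_three (powerset_cat X) (we M)"
    using strong by (simp add: strong_model_structure_def model_structure_def)
  then show ?thesis
    using assms model_arr(2)[OF assms(3)] unfolding two_out_of_three_powerset_iff by blast
qed

lemma model_wfs:
  "weak_factorization_system (powerset_cat X) (acyclic_cof M) (fib M)"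
  "weak_factorization_system (powerset_cat X) (cof M) (acyclic_fib M)"
  using strong by (simp_all add: strong_model_structure_def model_structure_def)

lemmas acyclic_cof_fib_factor = weak_factorization_system_powersetD(1)[OF model_wfs(1)]
lemmas acyclic_cof_fib_lift = weak_factorization_system_powersetD(2)[OF model_wfs(1)]
lemmas cof_acyclic_fib_factor = weak_factorization_system_powersetD(1)[OF model_wfs(2)]
lemmas cof_acyclic_fib_lift = weak_factorization_system_powersetD(2)[OF model_wfs(2)]

text \<open>Every intermediate \<open>V\<close> splits \<open>(U, W)\<close> into composable
  inclusions, so strength applies to each such \<open>V\<close>.\<close>

lemma acyclic_cof_left_cancel:
  assumes "(U, W) \<in> acyclic_cof M" "U \<subseteq> V" "V \<subseteq> W"
  shows "(U, V) \<in> acyclic_cof M"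
proof -
  have "(U, V) \<in> Arr (powerset_cat X)" "(V, W) \<in> Arr (powerset_cat X)"
    using acyclic_arr(1)[OF assms(1)] assms by (auto simp: Arr_powerset_iff)
  then show ?thesis
    using strong assms(1) by (fastforce simp: strong_model_structure_def powerset_cat_def)
qed

lemma acyclic_fib_right_cancel:
  assumes "(U, W) \<in> acyclic_fib M" "U \<subseteq> V" "V \<subseteq> W"
  shows "(V, W) \<in> acyclic_fib M"
proof -
  have "(U, V) \<in> Arr (powerset_cat X)" "(V, W) \<in> Arr (powerset_cat X)"
    using acyclic_arr(2)[OF assms(1)] assms by (auto simp: Arr_powerset_iff)
  then show ?thesis
    using strong assms(1) by (fastforce simp: strong_model_structure_def powerset_cat_def)
qed

text \<open>Existence comes from factoring \<open>U \<subseteq> X\<close>. For uniqueness, the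
  acyclic cofibration of one candidate lifts against the fibration of the other, in both
  orders.\<close>

lemma ex1_fibrant_replacement:
  assumes "U \<subseteq> X"
  shows "\<exists>!K. fibrant_replacement X M U K"
proof (rule ex_ex1I)
  show "\<exists>K. fibrant_replacement X M U K"
    using acyclic_cof_fib_factor[OF assms] by (auto simp: fibrant_replacement_def)
next
  fix K K'
  assume K: "fibrant_replacement X M U K" "fibrant_replacement X M U K'"
  have "A \<subseteq> B" if "fibrant_replacement X M U A" "fibrant_replacement X M U B" for A B
    using that acyclic_arr(1) acyclic_cof_fib_lift unfolding fibrant_replacement_def by meson
  then show "K = K'"
    using K by blast
qed

text \<open>Dual argument, factoring \<open>{} \<subseteq> U\<close>.\<close>

lemma ex1_cofibrant_replacement:
  assumes "U \<subseteq> X"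
  shows "\<exists>!K. cofibrant_replacement M U K"
proof (rule ex_ex1I)
  show "\<exists>K. cofibrant_replacement M U K"
    using cof_acyclic_fib_factor[OF _ assms] by (auto simp: cofibrant_replacement_def)
next
  fix K K'
  assume K: "cofibrant_replacement M U K" "cofibrant_replacement M U K'"
  have "A \<subseteq> B" if "cofibrant_replacement M U A" "cofibrant_replacement M U B" for A B
    using that acyclic_arr(2) cof_acyclic_fib_lift unfolding cofibrant_replacement_def
    by (meson empty_subsetI)
  then show "K = K'"
    using K by blast
qed

context
  fixes Cl Intr
  assumes ops: "replacement_operators X M = (Cl, Intr)"
begin

text \<open>Unique existence ensures that the definite description in
  \<open>replacement_operators\<close> yields an actual replacement.\<close>

lemma fibrant_replacement_Cl:
  assumes "U \<subseteq> X" shows "(U, Cl U) \<in> acyclic_cof M" "(Cl U, X) \<in> fib M"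
proof -
  have "Cl U = (THE K. fibrant_replacement X M U K)"
    using ops assms by (auto simp: replacement_operators_def)
  then have "fibrant_replacement X M U (Cl U)"
    using theI'[OF ex1_fibrant_replacement[OF assms]] by simp
  then show "(U, Cl U) \<in> acyclic_cof M" "(Cl U, X) \<in> fib M"
    by (simp_all add: fibrant_replacement_def)
qed

lemma cofibrant_replacement_Intr:
  assumes "U \<subseteq> X" shows "({}, Intr U) \<in> cof M" "(Intr U, U) \<in> acyclic_fib M"
proof -
  have "Intr U = (THE K. cofibrant_replacement M U K)"
    using ops assms by (auto simp: replacement_operators_def)
  then have "cofibrant_replacement M U (Intr U)"
    using theI'[OF ex1_cofibrant_replacement[OF assms]] by simp
  then show "({}, Intr U) \<in> cof M" "(Intr U, U) \<in> acyclic_fib M"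
    by (simp_all add: cofibrant_replacement_def)
qed

lemma acyclic_cof_iff: "(U, V) \<in> acyclic_cof M \<longleftrightarrow> U \<subseteq> V \<and> V \<subseteq> X \<and> V \<subseteq> Cl U"
proof
  assume UV: "(U, V) \<in> acyclic_cof M"
  then have *: "U \<subseteq> V" "V \<subseteq> X" "U \<subseteq> X"
    using acyclic_arr(1) by blast+
  then have "U \<subseteq> Cl U"
    using acyclic_arr(1)[OF fibrant_replacement_Cl(1)] by blast
  then show "U \<subseteq> V \<and> V \<subseteq> X \<and> V \<subseteq> Cl U"
    using acyclic_cof_fib_lift[OF UV fibrant_replacement_Cl(2)] * by blast
next
  assume "U \<subseteq> V \<and> V \<subseteq> X \<and> V \<subseteq> Cl U"
  then show "(U, V) \<in> acyclic_cof M"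
    using acyclic_cof_left_cancel fibrant_replacement_Cl(1) by (meson subset_trans)
qed

lemma acyclic_fib_iff: "(U, V) \<in> acyclic_fib M \<longleftrightarrow> U \<subseteq> V \<and> V \<subseteq> X \<and> Intr V \<subseteq> U"
proof
  assume UV: "(U, V) \<in> acyclic_fib M"
  then have *: "U \<subseteq> V" "V \<subseteq> X"
    using acyclic_arr(2) by blast+
  then have "Intr V \<subseteq> V"
    using acyclic_arr(2)[OF cofibrant_replacement_Intr(2)] by blast
  then show "U \<subseteq> V \<and> V \<subseteq> X \<and> Intr V \<subseteq> U"
    using cof_acyclic_fib_lift[OF cofibrant_replacement_Intr(1) UV] * by blast
next
  assume "U \<subseteq> V \<and> V \<subseteq> X \<and> Intr V \<subseteq> U"
  then show "(U, V) \<in> acyclic_fib M"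
    using acyclic_fib_right_cancel cofibrant_replacement_Intr(2) by blast
qed

lemma Cl_extensive: "U \<subseteq> X \<Longrightarrow> U \<subseteq> Cl U" "U \<subseteq> X \<Longrightarrow> Cl U \<subseteq> X"
  using fibrant_replacement_Cl acyclic_arr(1) by blast+

lemma Intr_intensive: "U \<subseteq> X \<Longrightarrow> Intr U \<subseteq> U"
  using cofibrant_replacement_Intr acyclic_arr(2) by blast

text \<open>Lift \<open>(U, Cl U)\<close> against \<open>(Cl V, X)\<close>.\<close>

lemma Cl_mono: "U \<subseteq> V \<Longrightarrow> V \<subseteq> X \<Longrightarrow> Cl U \<subseteq> Cl V"
  using acyclic_cof_fib_lift[OF fibrant_replacement_Cl(1) fibrant_replacement_Cl(2)] Cl_extensive
  by (meson subset_trans)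

lemma Intr_mono: "U \<subseteq> V \<Longrightarrow> V \<subseteq> X \<Longrightarrow> Intr U \<subseteq> Intr V"
  using cof_acyclic_fib_lift[OF cofibrant_replacement_Intr(1) cofibrant_replacement_Intr(2)]
    Intr_intensive by (meson empty_subsetI subset_trans)

text \<open>The composite of \<open>(U, Cl U)\<close> and \<open>(Cl U, Cl (Cl U))\<close> is an
  acyclic cofibration, so its target is bounded by \<open>Cl U\<close>.\<close>

lemma Cl_idem: "U \<subseteq> X \<Longrightarrow> Cl (Cl U) = Cl U"
  using acyclic_comp(1)[OF fibrant_replacement_Cl(1) fibrant_replacement_Cl(1)] Cl_extensive
  unfolding acyclic_cof_iff by (meson subset_antisym)

lemma Intr_idem: "U \<subseteq> X \<Longrightarrow> Intr (Intr U) = Intr U"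
  using acyclic_comp(2)[OF cofibrant_replacement_Intr(2) cofibrant_replacement_Intr(2)]
    Intr_intensive
  unfolding acyclic_fib_iff by (meson subset_antisym subset_trans)

lemma we_iff: "(U, V) \<in> we M \<longleftrightarrow> U \<subseteq> V \<and> V \<subseteq> X \<and> Intr V \<subseteq> Cl U"
proof
  assume UV: "(U, V) \<in> we M"
  then have *: "U \<subseteq> V" "V \<subseteq> X"
    using model_arr(2) by blast+
  \<comment> \<open>Two-out-of-three makes the first factor acyclic, whence
    \<open>Intr V \<subseteq> W \<subseteq> Cl U\<close>.\<close>
  obtain W where W: "(U, W) \<in> cof M" "(W, V) \<in> acyclic_fib M"
    using cof_acyclic_fib_factor * by blast
  have "(U, W) \<in> we M"
    using UV W we_cancel model_arr(1) by (auto simp: acyclic_fib_def)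
  then have "(U, W) \<in> acyclic_cof M"
    using W by (simp add: acyclic_cof_def)
  then show "U \<subseteq> V \<and> V \<subseteq> X \<and> Intr V \<subseteq> Cl U"
    using W(2) * unfolding acyclic_cof_iff acyclic_fib_iff by blast
next
  assume *: "U \<subseteq> V \<and> V \<subseteq> X \<and> Intr V \<subseteq> Cl U"
  \<comment> \<open>\<open>U \<union> Intr V\<close> is the least set containing \<open>U\<close>
    from which the inclusion into \<open>V\<close> is an acyclic fibration; the hypothesis keeps it
    inside \<open>Cl U\<close>.\<close>
  then have "(U, U \<union> Intr V) \<in> acyclic_cof M" "(U \<union> Intr V, V) \<in> acyclic_fib M"
    unfolding acyclic_cof_iff acyclic_fib_iff
    using Intr_intensive[of V] Cl_extensive[of U] by blast+
  then show "(U, V) \<in> we M"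
    using model_comp(2) unfolding acyclic_cof_def acyclic_fib_def by blast
qed

lemma fib_iff: "(U, V) \<in> fib M \<longleftrightarrow> U \<subseteq> V \<and> V \<subseteq> X \<and> Cl U \<inter> V \<subseteq> U"
proof
  assume UV: "(U, V) \<in> fib M"
  then have *: "U \<subseteq> V" "V \<subseteq> X" "U \<subseteq> X"
    using model_arr(3) by blast+
  \<comment> \<open>This is the largest acyclic cofibration out of \<open>U\<close> with target
    inside \<open>V\<close>; lifting it against \<open>(U, V)\<close> gives the claim.\<close>
  then have "(U, Cl U \<inter> V) \<in> acyclic_cof M"
    using Cl_extensive(1) by (auto simp: acyclic_cof_iff)
  then show "U \<subseteq> V \<and> V \<subseteq> X \<and> Cl U \<inter> V \<subseteq> U"
    using acyclic_cof_fib_lift[OF _ UV] * by blast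
next
  assume *: "U \<subseteq> V \<and> V \<subseteq> X \<and> Cl U \<inter> V \<subseteq> U"
  show "(U, V) \<in> fib M"
  proof (rule weak_factorization_system_powersetD(4)[OF model_wfs(1)])
    fix A B
    \<comment> \<open>Here \<open>B \<subseteq> Cl A \<subseteq> Cl U\<close>, so \<open>B\<close>
      lies in the trace \<open>Cl U \<inter> V\<close>.\<close>
    assume "(A, B) \<in> acyclic_cof M" "A \<subseteq> U" "B \<subseteq> V"
    then show "B \<subseteq> U"
      using * Cl_mono[of A U] unfolding acyclic_cof_iff by blast
  qed (use * in auto)
qed

lemma cof_iff: "(U, V) \<in> cof M \<longleftrightarrow> U \<subseteq> V \<and> V \<subseteq> X \<and> V \<subseteq> U \<union> Intr V"
proof
  assume UV: "(U, V) \<in> cof M"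
  then have *: "U \<subseteq> V" "V \<subseteq> X"
    using model_arr(1) by blast+
  then have "(U \<union> Intr V, V) \<in> acyclic_fib M"
    using Intr_intensive by (auto simp: acyclic_fib_iff)
  then show "U \<subseteq> V \<and> V \<subseteq> X \<and> V \<subseteq> U \<union> Intr V"
    using cof_acyclic_fib_lift[OF UV] * by blast
next
  assume *: "U \<subseteq> V \<and> V \<subseteq> X \<and> V \<subseteq> U \<union> Intr V"
  show "(U, V) \<in> cof M"
  proof (rule weak_factorization_system_powersetD(3)[OF model_wfs(2)])
    fix C D
    assume "(C, D) \<in> acyclic_fib M" "U \<subseteq> C" "V \<subseteq> D"
    then show "V \<subseteq> C"
      using * Intr_mono[of V D] unfolding acyclic_fib_iff by blast
  qed (use * in auto)
qed

text \<open>All three classes are recovered from the replacement operators, which gives injectivity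
  of \<open>replacement_operators\<close>.\<close>

lemma model_eq_operator_model: "M = operator_model X Cl Intr"
proof -
  have "cof M = {(U, V). U \<subseteq> V \<and> V \<subseteq> X \<and> V \<subseteq> U \<union> Intr V}"
    "we M = {(U, V). U \<subseteq> V \<and> V \<subseteq> X \<and> Intr V \<subseteq> Cl U}"
    "fib M = {(U, V). U \<subseteq> V \<and> V \<subseteq> X \<and> Cl U \<inter> V \<subseteq> U}"
    by (simp_all add: set_eq_iff cof_iff we_iff fib_iff)
  then show ?thesis
    unfolding operator_model_def by (metis (full_types) model_data.surjective old.unit.exhaust)
qed

text \<open>Condition (ii) is the lifting of the acyclic cofibration \<open>(U, Cl U)\<close>
  against the fibration \<open>(Intr V, V)\<close>.\<close>

lemma lift_Cl_Intr:
  assumes "U \<subseteq> Intr V" "Cl U \<subseteq> V" "V \<subseteq> X"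
  shows "Cl U \<subseteq> Intr V"
proof -
  have "U \<subseteq> X"
    using assms Intr_intensive by blast
  moreover have "(Intr V, V) \<in> fib M"
    using cofibrant_replacement_Intr(2)[OF assms(3)] by (simp add: acyclic_fib_def)
  ultimately show ?thesis
    using acyclic_cof_fib_lift[OF fibrant_replacement_Cl(1)] assms by blast
qed

text \<open>One inclusion is \<open>lift_Cl_Intr\<close> for the pair \<open>Intr U\<close>,
  \<open>Cl U\<close>. The other reads \<open>we_iff\<close> on \<open>(Intr U, Cl U)\<close>, an
  acyclic fibration followed by an acyclic cofibration.\<close>

lemma Cl_Intr_commute:
  assumes "U \<subseteq> X"
  shows "Cl (Intr U) = Intr (Cl U)"
proof
  show "Cl (Intr U) \<subseteq> Intr (Cl U)"
    using assms by (intro lift_Cl_Intr Intr_mono Cl_mono Cl_extensive Intr_intensive)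
  have "(Intr U, Cl U) \<in> we M"
    using model_comp(2) cofibrant_replacement_Intr(2)[OF assms] fibrant_replacement_Cl(1)[OF assms]
    by (auto simp: acyclic_cof_def acyclic_fib_def)
  then show "Intr (Cl U) \<subseteq> Cl (Intr U)"
    by (simp add: we_iff)
qed

text \<open>Such an inclusion is both an acyclic cofibration and a fibration, so it lifts against itself.\<close>

lemma eq_if_Cl_Intr_eq:
  assumes "U \<subseteq> V" "V \<subseteq> X" "Cl U = Cl V" "Intr U = Intr V"
  shows "U = V"
proof -
  have U: "U \<subseteq> X"
    using assms by blast
  have "(U, V) \<in> acyclic_cof M" "(U, V) \<in> acyclic_fib M"
    using assms Cl_extensive(1)[of V] Intr_intensive[OF U]
    by (auto simp: acyclic_cof_iff acyclic_fib_iff)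
  then show ?thesis
    using acyclic_cof_fib_lift[of U V U V] assms(1) by (auto simp: acyclic_fib_def)
qed

lemma compatible_replacement_operators: "compatible_operators X Cl Intr"
proof -
  \<comment> \<open>The restriction to \<open>Pow X\<close> in \<open>replacement_operators\<close>
    provides extensionality.\<close>
  have ext: "Cl \<in> extensional (Pow X)" "Intr \<in> extensional (Pow X)"
    using ops by (auto simp: replacement_operators_def)
  have "closure_operator X Cl"
    using ext Cl_extensive Cl_mono Cl_idem by (simp add: closure_operator_def PiE_def)
  moreover have "interior_operator X Intr"
    using ext Intr_intensive Intr_mono Intr_idem order_trans[OF Intr_intensive]
    by (simp add: interior_operator_def PiE_def)
  ultimately show ?thesis
    using Cl_Intr_commute lift_Cl_Intr eq_if_Cl_Intr_eq by (simp add: compatible_operators_def)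
qed

end

end

section \<open>From operators to strong model structures\<close>

context
  fixes X :: "'a set" and Cl Intr
  assumes comp: "compatible_operators X Cl Intr"
begin

lemma closure_ops:
  "U \<subseteq> X \<Longrightarrow> Cl U \<subseteq> X"
  "U \<subseteq> X \<Longrightarrow> U \<subseteq> Cl U"
  "U \<subseteq> X \<Longrightarrow> Cl (Cl U) = Cl U"
  "U \<subseteq> V \<Longrightarrow> V \<subseteq> X \<Longrightarrow> Cl U \<subseteq> Cl V"
  using comp by (auto simp: compatible_operators_def closure_operator_def PiE_def Pi_def)

lemma interior_ops:
  "U \<subseteq> X \<Longrightarrow> Intr U \<subseteq> U"
  "U \<subseteq> X \<Longrightarrow> Intr (Intr U) = Intr U"
  "U \<subseteq> V \<Longrightarrow> V \<subseteq> X \<Longrightarrow> Intr U \<subseteq> Intr V"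
  using comp by (auto simp: compatible_operators_def interior_operator_def)

lemma closure_interior_commute: "U \<subseteq> X \<Longrightarrow> Cl (Intr U) = Intr (Cl U)"
  using comp by (simp add: compatible_operators_def)

lemma operators_separate:
  "U \<subseteq> V \<Longrightarrow> V \<subseteq> X \<Longrightarrow> Cl U = Cl V \<Longrightarrow> Intr U = Intr V \<Longrightarrow> U = V"
  using comp by (simp add: compatible_operators_def)

text \<open>Sandwich: \<open>Cl U \<subseteq> Cl V \<subseteq> Cl (Cl U) = Cl U\<close>.\<close>

lemma closure_eq_between: "U \<subseteq> V \<Longrightarrow> V \<subseteq> X \<Longrightarrow> V \<subseteq> Cl U \<Longrightarrow> Cl V = Cl U"
  by (metis closure_ops(1,3,4) subset_antisym subset_trans)

lemma interior_eq_between: "U \<subseteq> V \<Longrightarrow> V \<subseteq> X \<Longrightarrow> Intr V \<subseteq> U \<Longrightarrow> Intr U = Intr V"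
  by (metis interior_ops(2,3) subset_antisym subset_trans)

lemma acyclic_cof_operator_model_iff:
  "(U, V) \<in> acyclic_cof (operator_model X Cl Intr) \<longleftrightarrow> U \<subseteq> V \<and> V \<subseteq> X \<and> V \<subseteq> Cl U"
proof
  assume "(U, V) \<in> acyclic_cof (operator_model X Cl Intr)"
  then show "U \<subseteq> V \<and> V \<subseteq> X \<and> V \<subseteq> Cl U"
    using closure_ops(2)[of U] order_trans[of U V X]
    by (auto simp: acyclic_cof_def operator_model_def)
next
  assume *: "U \<subseteq> V \<and> V \<subseteq> X \<and> V \<subseteq> Cl U"
  \<comment> \<open>The cofibration condition says \<open>?W = V\<close>. Both sets have the same
    closure and the same interior, so condition (iii) identifies them.\<close>
  let ?W = "U \<union> Intr V"
  have W: "U \<subseteq> ?W" "Intr V \<subseteq> ?W" "?W \<subseteq> V"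
    using * interior_ops(1)[of V] by auto
  have "Cl ?W = Cl V"
    using closure_eq_between[of U ?W] closure_eq_between[of U V] * W by blast
  moreover have "Intr ?W = Intr V"
    using interior_eq_between[of ?W V] * W by blast
  ultimately have "?W = V"
    using operators_separate W * by blast
  then show "(U, V) \<in> acyclic_cof (operator_model X Cl Intr)"
    using * W by (auto simp: acyclic_cof_def operator_model_def)
qed

lemma acyclic_fib_operator_model_iff:
  "(U, V) \<in> acyclic_fib (operator_model X Cl Intr) \<longleftrightarrow> U \<subseteq> V \<and> V \<subseteq> X \<and> Intr V \<subseteq> U"
proof
  assume "(U, V) \<in> acyclic_fib (operator_model X Cl Intr)"
  then show "U \<subseteq> V \<and> V \<subseteq> X \<and> Intr V \<subseteq> U"
    using interior_ops(1)[of V] by (auto simp: acyclic_fib_def operator_model_def)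
next
  assume *: "U \<subseteq> V \<and> V \<subseteq> X \<and> Intr V \<subseteq> U"
  \<comment> \<open>Dually, the fibration condition says \<open>U = ?W\<close>, again by condition
    (iii).\<close>
  let ?W = "Cl U \<inter> V"
  have W: "U \<subseteq> ?W" "?W \<subseteq> Cl U" "?W \<subseteq> V"
    using * closure_ops(2)[of U] by auto
  have "Intr U = Intr ?W"
    using interior_eq_between[of ?W V] interior_eq_between[of U V] * W by blast
  moreover have "Cl U = Cl ?W"
    using closure_eq_between[of U ?W] * W by blast
  ultimately have "U = ?W"
    using operators_separate[of U ?W] W * by blast
  then show "(U, V) \<in> acyclic_fib (operator_model X Cl Intr)"
    using * W by (auto simp: acyclic_fib_def operator_model_def)
qed

lemma fib_operator_model_iff:
  "(U, V) \<in> fib (operator_model X Cl Intr) \<longleftrightarrow> U \<subseteq> V \<and> V \<subseteq> X \<and> Cl U \<inter> V \<subseteq> U"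
  by (simp add: operator_model_def)

lemma cof_operator_model_iff:
  "(U, V) \<in> cof (operator_model X Cl Intr) \<longleftrightarrow> U \<subseteq> V \<and> V \<subseteq> X \<and> V \<subseteq> U \<union> Intr V"
  by (simp add: operator_model_def)

lemma we_operator_model_iff:
  "(U, V) \<in> we (operator_model X Cl Intr) \<longleftrightarrow> U \<subseteq> V \<and> V \<subseteq> X \<and> Intr V \<subseteq> Cl U"
  by (simp add: operator_model_def)

section \<open>Verification of the strong model structure axioms\<close>

lemma wide_subcategory_cof_operator_model:
  "wide_subcategory (powerset_cat X) (cof (operator_model X Cl Intr))"
proof -
  \<comment> \<open>A point of \<open>W\<close> outside \<open>Intr W\<close> lies in
    \<open>V\<close>, and it lies in \<open>U\<close> because
    \<open>Intr V \<subseteq> Intr W\<close>.\<close>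
  have "W \<subseteq> U \<union> Intr W"
    if "V \<subseteq> W" "W \<subseteq> X" "V \<subseteq> U \<union> Intr V" "W \<subseteq> V \<union> Intr W" for U V W
    using interior_ops(3)[of V W] that by blast
  then show ?thesis
    unfolding wide_subcategory_powerset_iff cof_operator_model_iff
    by (meson Un_upper1 subset_refl subset_trans)
qed

lemma wide_subcategory_fib_operator_model:
  "wide_subcategory (powerset_cat X) (fib (operator_model X Cl Intr))"
proof -
  have "Cl U \<inter> W \<subseteq> U"
    if "U \<subseteq> V" "V \<subseteq> X" "Cl U \<inter> V \<subseteq> U" "Cl V \<inter> W \<subseteq> V" for U V W
    using closure_ops(4)[of U V] that by blast
  then show ?thesis
    unfolding wide_subcategory_powerset_iff fib_operator_model_iff
    by (meson inf_le2 subset_refl subset_trans)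
qed

text \<open>Weak equivalences compose because \<open>Intr (Cl V) = Cl (Intr V)\<close>.\<close>

lemma we_operator_model_comp:
  assumes "U \<subseteq> V" "V \<subseteq> W" "W \<subseteq> X" "Intr V \<subseteq> Cl U" "Intr W \<subseteq> Cl V"
  shows "Intr W \<subseteq> Cl U"
proof -
  have X: "U \<subseteq> X" "V \<subseteq> X"
    using assms by auto
  have "Intr W = Intr (Intr W)"
    using interior_ops(2) assms(3) by simp
  also have "\<dots> \<subseteq> Intr (Cl V)"
    using interior_ops(3) assms(5) closure_ops(1) X by simp
  also have "\<dots> = Cl (Intr V)"
    using closure_interior_commute X by simp
  also have "\<dots> \<subseteq> Cl (Cl U)"
    using closure_ops(1,4) assms(4) X by simp
  also have "\<dots> = Cl U"
    using closure_ops(3) X by simp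
  finally show ?thesis .
qed

lemma wide_subcategory_we_operator_model:
  "wide_subcategory (powerset_cat X) (we (operator_model X Cl Intr))"
  unfolding wide_subcategory_powerset_iff we_operator_model_iff
  using we_operator_model_comp interior_ops(1) closure_ops(2) by (meson subset_refl subset_trans)

text \<open>In the cancellation cases, monotonicity enlarges \<open>Cl U\<close> to
  \<open>Cl V\<close> or shrinks \<open>Intr W\<close> to \<open>Intr V\<close>; the composition
  case is \<open>we_operator_model_comp\<close>.\<close>

lemma two_out_of_three_operator_model:
  "two_out_of_three (powerset_cat X) (we (operator_model X Cl Intr))"
proof -
  have "Intr W \<subseteq> Cl V" if "U \<subseteq> V" "V \<subseteq> X" "Intr W \<subseteq> Cl U" for U V W
    using closure_ops(4)[of U V] that by blast
  moreover have "Intr V \<subseteq> Cl U" if "V \<subseteq> W" "W \<subseteq> X" "Intr W \<subseteq> Cl U" for U V W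
    using interior_ops(3)[of V W] that by blast
  ultimately show ?thesis
    unfolding two_out_of_three_powerset_iff we_operator_model_iff
    using we_operator_model_comp by (meson subset_trans)
qed

lemma acyclic_cof_wfs_operator_model:
  "weak_factorization_system (powerset_cat X)
     (acyclic_cof (operator_model X Cl Intr)) (fib (operator_model X Cl Intr))"
proof -
  let ?F = "\<lambda>U V. U \<subseteq> V \<and> V \<subseteq> X \<and> Cl U \<inter> V \<subseteq> U"
  let ?C = "\<lambda>U V. U \<subseteq> V \<and> V \<subseteq> X \<and> V \<subseteq> Cl U"
  \<comment> \<open>The middle set has closure \<open>Cl U\<close>, since it lies between
    \<open>U\<close> and \<open>Cl U\<close>; hence it is relatively closed in
    \<open>V\<close>.\<close>
  have factor: "?C U (Cl U \<inter> V) \<and> ?F (Cl U \<inter> V) V" if "U \<subseteq> V" "V \<subseteq> X" for U V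
    using that closure_ops(2)[of U] closure_eq_between[of U "Cl U \<inter> V"] by blast
  have lift: "B \<subseteq> C" if "?C A B" "?F C D" "A \<subseteq> C" "B \<subseteq> D" for A B C D
    using that closure_ops(4)[of A C] by blast
  show ?thesis
  proof (rule weak_factorization_system_powersetI;
      (unfold acyclic_cof_operator_model_iff fib_operator_model_iff)?)
    show "acyclic_cof (operator_model X Cl Intr) \<subseteq> Arr (powerset_cat X)"
      "fib (operator_model X Cl Intr) \<subseteq> Arr (powerset_cat X)"
      by (auto simp: Arr_powerset_iff acyclic_cof_operator_model_iff fib_operator_model_iff)
    \<comment> \<open>Retract argument: an arrow with the left lifting property is tested against
      the second factor of its own factorization, and below an arrow with the right lifting property
      against the first.\<close>
    show "?C A B" if "A \<subseteq> B" "B \<subseteq> X" "\<And>C D. ?F C D \<Longrightarrow> A \<subseteq> C \<Longrightarrow> B \<subseteq> D \<Longrightarrow> B \<subseteq> C" for A B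
      using that(1,2) that(3)[of "Cl A \<inter> B" B] factor[of A B] by blast
    show "?F C D" if "C \<subseteq> D" "D \<subseteq> X" "\<And>A B. ?C A B \<Longrightarrow> A \<subseteq> C \<Longrightarrow> B \<subseteq> D \<Longrightarrow> B \<subseteq> C" for C D
      using that(1,2) that(3)[of C "Cl C \<inter> D"] factor[of C D] by blast
  qed (use factor lift in meson)+
qed

lemma acyclic_fib_wfs_operator_model:
  "weak_factorization_system (powerset_cat X)
     (cof (operator_model X Cl Intr)) (acyclic_fib (operator_model X Cl Intr))"
proof -
  let ?F = "\<lambda>U V. U \<subseteq> V \<and> V \<subseteq> X \<and> Intr V \<subseteq> U"
  let ?C = "\<lambda>U V. U \<subseteq> V \<and> V \<subseteq> X \<and> V \<subseteq> U \<union> Intr V"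
  \<comment> \<open>The middle set has interior \<open>Intr V\<close>, since it lies between
    \<open>Intr V\<close> and \<open>V\<close>.\<close>
  have factor: "?C U (U \<union> Intr V) \<and> ?F (U \<union> Intr V) V" if "U \<subseteq> V" "V \<subseteq> X" for U V
    using that interior_ops(1)[of V] interior_eq_between[of "U \<union> Intr V" V] by blast
  have lift: "B \<subseteq> C" if "?C A B" "?F C D" "A \<subseteq> C" "B \<subseteq> D" for A B C D
    using that interior_ops(3)[of B D] by blast
  show ?thesis
  proof (rule weak_factorization_system_powersetI;
      (unfold acyclic_fib_operator_model_iff cof_operator_model_iff)?)
    show "cof (operator_model X Cl Intr) \<subseteq> Arr (powerset_cat X)"
      "acyclic_fib (operator_model X Cl Intr) \<subseteq> Arr (powerset_cat X)"
      by (auto simp: Arr_powerset_iff acyclic_fib_operator_model_iff cof_operator_model_iff)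
    show "?C A B" if "A \<subseteq> B" "B \<subseteq> X" "\<And>C D. ?F C D \<Longrightarrow> A \<subseteq> C \<Longrightarrow> B \<subseteq> D \<Longrightarrow> B \<subseteq> C" for A B
      using that(1,2) that(3)[of "A \<union> Intr B" B] factor[of A B] by blast
    show "?F C D" if "C \<subseteq> D" "D \<subseteq> X" "\<And>A B. ?C A B \<Longrightarrow> A \<subseteq> C \<Longrightarrow> B \<subseteq> D \<Longrightarrow> B \<subseteq> C" for C D
      using that(1,2) that(3)[of C "C \<union> Intr D"] factor[of C D] by blast
  qed (use factor lift in meson)+
qed

text \<open>With the acyclic classes described by \<open>V \<subseteq> Cl U\<close> and
  \<open>Intr V \<subseteq> U\<close>, strength is transitivity of inclusion.\<close>

lemma strong_operator_model:
  "strong_model_structure (powerset_cat X) (operator_model X Cl Intr)"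
proof -
  have "model_structure (powerset_cat X) (operator_model X Cl Intr)"
    by (simp add: model_structure_def retract_closed_powerset two_out_of_three_operator_model
        wide_subcategory_cof_operator_model wide_subcategory_fib_operator_model
        wide_subcategory_we_operator_model acyclic_cof_wfs_operator_model
        acyclic_fib_wfs_operator_model)
  then show ?thesis
    by (auto simp: strong_model_structure_def powerset_cat_def acyclic_cof_operator_model_iff
        acyclic_fib_operator_model_iff)
qed

text \<open>By uniqueness it suffices that \<open>Cl U\<close> and \<open>Intr U\<close> are
  replacements; idempotence makes \<open>(Cl U, X)\<close> a fibration and
  \<open>({}, Intr U)\<close> a cofibration.\<close>

lemma replacement_operators_operator_model:
  "replacement_operators X (operator_model X Cl Intr) = (Cl, Intr)"
proof -
  let ?M = "operator_model X Cl Intr"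
  have "(THE K. fibrant_replacement X ?M U K) = Cl U" if "U \<subseteq> X" for U
  proof (rule the1_equality[OF ex1_fibrant_replacement[OF strong_operator_model that]])
    show "fibrant_replacement X ?M U (Cl U)"
      using that closure_ops
      by (simp add: fibrant_replacement_def acyclic_cof_operator_model_iff fib_operator_model_iff)
  qed
  moreover have "(THE K. cofibrant_replacement ?M U K) = Intr U" if "U \<subseteq> X" for U
  proof (rule the1_equality[OF ex1_cofibrant_replacement[OF strong_operator_model that]])
    show "cofibrant_replacement ?M U (Intr U)"
      using that interior_ops[of U]
      by (auto simp: cofibrant_replacement_def acyclic_fib_operator_model_iff cof_operator_model_iff)
  qed
  moreover have "Cl \<in> extensional (Pow X)" "Intr \<in> extensional (Pow X)"
    using comp
    by (auto simp: compatible_operators_def closure_operator_def interior_operator_def PiE_def)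
  ultimately show ?thesis
    by (auto simp: replacement_operators_def intro!: extensionalityI[of _ "Pow X"])
qed

end

text \<open>The first conjunct certifies that the definite descriptions in
  \<open>replacement_operators\<close> denote, so the bijection really is given by fibrant and
  cofibrant replacement.\<close>

theorem proposition4p3:
  fixes X :: "'a set"
  shows "(\<forall>M. strong_model_structure (powerset_cat X) M \<longrightarrow>
            (\<forall>U\<in>Pow X. (\<exists>!K. fibrant_replacement X M U K) \<and>
                        (\<exists>!K. cofibrant_replacement M U K))) \<and>
         bij_betw (replacement_operators X)
           {M. strong_model_structure (powerset_cat X) M}
           {(Cl, Intr). closure_operator X Cl \<and> interior_operator X Intr \<and>
              (\<forall>U\<in>Pow X. Cl (Intr U) = Intr (Cl U)) \<and>
              (\<forall>U\<in>Pow X. \<forall>V\<in>Pow X.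
                 U \<subseteq> Intr V \<longrightarrow> Cl U \<subseteq> V \<longrightarrow> Cl U \<subseteq> Intr V) \<and>
              (\<forall>U\<in>Pow X. \<forall>V\<in>Pow X.
                 U \<subseteq> V \<longrightarrow> Cl U = Cl V \<longrightarrow> Intr U = Intr V \<longrightarrow> U = V)}"
  unfolding compatible_operators_def[symmetric]
proof (intro conjI)
  show "\<forall>M. strong_model_structure (powerset_cat X) M \<longrightarrow>
      (\<forall>U\<in>Pow X. (\<exists>!K. fibrant_replacement X M U K) \<and> (\<exists>!K. cofibrant_replacement M U K))"
    by (simp add: ex1_fibrant_replacement ex1_cofibrant_replacement)
  show "bij_betw (replacement_operators X) {M. strong_model_structure (powerset_cat X) M}
      {(Cl, Intr). compatible_operators X Cl Intr}"
  \<comment> \<open>The formulas of \<open>operator_model\<close> give the two-sided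
    inverse.\<close>
  proof (rule bij_betw_byWitness[where f' = "\<lambda>(Cl, Intr). operator_model X Cl Intr"])
    show "\<forall>M\<in>{M. strong_model_structure (powerset_cat X) M}.
        (case replacement_operators X M of (Cl, Intr) \<Rightarrow> operator_model X Cl Intr) = M"
      by (auto split: prod.split simp: model_eq_operator_model[symmetric])
    show "replacement_operators X ` {M. strong_model_structure (powerset_cat X) M}
        \<subseteq> {(Cl, Intr). compatible_operators X Cl Intr}"
      by (auto split: prod.split intro: compatible_replacement_operators[OF _ sym])
  qed (auto simp: strong_operator_model replacement_operators_operator_model)
qed

end
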